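(* Let $\Omega\subset\mathbb{C}$ be a simply connected domain, let $f=h\overline{g}$ be a non-vanishing sense-preserving logharmonic mapping defined in $\Omega$, and let $L(z)=z^a\overline{z^b}$ with $a,b\in\mathbb{C}$, $a\neq0$ and $|b|<|a|$. If $a+b=1$, then $P_f=P_{L\circ f}$ in $\Omega$.
   Context: A non-vanishing sense-preserving (locally univalent) logharmonic mapping $f=h\overline{g}$ on a domain: $h,g$ are non-vanishing analytic functions there, $h'$ does not vanish, and the (second complex) dilatation $\omega=\dfrac{g'h}{gh'}$ satisfies $|\omega|<1$ everywhere. Its pre-Schwarzian derivative is $$P_f=\frac{h''}{h'}+\omega\frac{h'}{h}-\frac{\omega'\overline{\omega}}{1-|\omega|^2}.$$ The composition $L\circ f=f^a\,\overline{f^b}$ is understood, using holomorphic branches of $\log h$ and $\log g$ on $\Omega$, as the logharmonic mapping $H\overline{G}$ with $H=h^a g^{\overline b}$ and $G=g^{\overline a}h^{b}$ (powers being $h^a=e^{a\log h}$, etc.). Its pre-Schwarzian derivative is computed by the same formula with $H$ and $W=\dfrac{G'H}{GH'}$ in place of $h$ and $\omega$. *)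

theory Defs
  imports "HOL-Complex_Analysis.Complex_Analysis"
begin

definition dilatation :: "(complex \<Rightarrow> complex) \<Rightarrow> (complex \<Rightarrow> complex) \<Rightarrow> complex \<Rightarrow> complex" where
  "dilatation h g z = (deriv g z * h z) / (g z * deriv h z)"

(* "f = h * cnj g on \<Omega>" with analytic factors h and g, which f determines up to (h, g) -> (c h, g / cnj c). *)
definition sense_preserving_logharmonic ::
  "complex set \<Rightarrow> (complex \<Rightarrow> complex) \<Rightarrow> (complex \<Rightarrow> complex) \<Rightarrow> (complex \<Rightarrow> complex) \<Rightarrow> bool" where
  "sense_preserving_logharmonic \<Omega> f h g \<longleftrightarrow>
     h holomorphic_on \<Omega> \<and> g holomorphic_on \<Omega> \<and>
     (\<forall>z\<in>\<Omega>. f z = h z * cnj (g z) \<and> h z \<noteq> 0 \<and> g z \<noteq> 0 \<and> deriv h z \<noteq> 0 \<and>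
            cmod (dilatation h g z) < 1)"

(* The value is unchanged under (h, g) -> (c h, g / cnj c), so it depends on f only. *)
definition pre_schwarzian :: "(complex \<Rightarrow> complex) \<Rightarrow> (complex \<Rightarrow> complex) \<Rightarrow> complex \<Rightarrow> complex" where
  "pre_schwarzian h g z =
     (let \<omega> = dilatation h g in
      deriv (deriv h) z / deriv h z + \<omega> z * (deriv h z / h z)
        - deriv \<omega> z * cnj (\<omega> z) / (1 - complex_of_real ((cmod (\<omega> z))\<^sup>2)))"

definition log_branch :: "complex set \<Rightarrow> (complex \<Rightarrow> complex) \<Rightarrow> (complex \<Rightarrow> complex) \<Rightarrow> bool" where
  "log_branch \<Omega> l h \<longleftrightarrow> l holomorphic_on \<Omega> \<and> (\<forall>z\<in>\<Omega>. exp (l z) = h z)"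

definition branch_power :: "(complex \<Rightarrow> complex) \<Rightarrow> complex \<Rightarrow> complex \<Rightarrow> complex" where
  "branch_power l a z = exp (a * l z)"

(* For L(w) = w^a * cnj (w^b): the analytic factors H = h^a * g^(cnj b) and G = g^(cnj a) * h^b of
   L o f, the powers being formed with branches lh of log h and lg of log g. *)
definition comp_H ::
  "complex \<Rightarrow> complex \<Rightarrow> (complex \<Rightarrow> complex) \<Rightarrow> (complex \<Rightarrow> complex) \<Rightarrow> complex \<Rightarrow> complex" where
  "comp_H a b lh lg z = branch_power lh a z * branch_power lg (cnj b) z"

definition comp_G ::
  "complex \<Rightarrow> complex \<Rightarrow> (complex \<Rightarrow> complex) \<Rightarrow> (complex \<Rightarrow> complex) \<Rightarrow> complex \<Rightarrow> complex" where
  "comp_G a b lh lg z = branch_power lg (cnj a) z * branch_power lh b z"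

lemma log_branch_exists:
  assumes "open \<Omega>" "simply_connected \<Omega>" "h holomorphic_on \<Omega>" "\<forall>z\<in>\<Omega>. h z \<noteq> 0"
  shows "\<exists>l. log_branch \<Omega> l h"
  using assms simply_connected_eq_holomorphic_log[OF assms(1)]
  unfolding log_branch_def by metis

(* lh + cnj lg is the branch of log f, for f = h * cnj g, with respect to which f^a and f^b are taken. *)
lemma comp_H_comp_G_eq:
  "comp_H a b lh lg z * cnj (comp_G a b lh lg z) =
     branch_power (\<lambda>z. lh z + cnj (lg z)) a z * cnj (branch_power (\<lambda>z. lh z + cnj (lg z)) b z)"
  by (simp add: comp_H_def comp_G_def branch_power_def exp_cnj exp_add[symmetric] algebra_simps)

end

(* Write u = h'/h and v = g'/g for the derivatives of log h and log g, so omega = v/u. In these terms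
   P_f = u + u'/u + omega u - omega' cnj omega / (1 - |omega|^2). Passing to L o f replaces u by
   a u + cnj b v = u (a + cnj b omega) and omega by the Moebius image
   W = (b + cnj a omega) / (a + cnj b omega). The two first-order terms sum to
   (a + b) u + cnj (a + b) omega u, which is unchanged when a + b = 1. The term contributed by the
   logarithmic derivative of a + cnj b omega is compensated by the last term, because
   |a + cnj b omega|^2 (1 - |W|^2) = (|a|^2 - |b|^2) (1 - |omega|^2). *)
theory Submission
  imports Defs
begin

lemma deriv_log_branch:
  assumes "open S" "log_branch S l h" "z \<in> S"
  shows "deriv h z = h z * deriv l z"
proof -
  have l: "(l has_field_derivative deriv l z) (at z)"
    using assms holomorphic_derivI unfolding log_branch_def by blast
  have "((\<lambda>w. exp (l w)) has_field_derivative exp (l z) * deriv l z) (at z)"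
    by (rule DERIV_fun_exp[OF l])
  then have "(h has_field_derivative exp (l z) * deriv l z) (at z)"
    by (rule has_field_derivative_transform_within_open[OF _ assms(1,3)])
      (use assms in \<open>auto simp: log_branch_def\<close>)
  then show ?thesis
    using assms by (auto simp: log_branch_def dest: DERIV_imp_deriv)
qed

lemma log_branch_nonzero: "log_branch S l h \<Longrightarrow> z \<in> S \<Longrightarrow> h z \<noteq> 0"
  unfolding log_branch_def by (metis exp_not_eq_zero)

text \<open>The factors \<open>h z\<close> and \<open>g z\<close> cancel, which leaves a quotient of
  logarithmic derivatives. Where \<open>deriv lh z\<close> is 0, both sides are 0, since division by
  0 gives 0.\<close>

lemma dilatation_log_branch:
  assumes "open S" "log_branch S lh h" "log_branch S lg g" "z \<in> S"
  shows "dilatation h g z = deriv lg z / deriv lh z"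
  using assms log_branch_nonzero[OF assms(2,4)] log_branch_nonzero[OF assms(3,4)]
  by (simp add: dilatation_def deriv_log_branch)

text \<open>Writing h as exp of \<open>lh\<close> and u = \<open>deriv lh\<close> gives h' = h u and
  h'' = h (u^2 + u'), so h''/h' = u + u'/u. The formula serves twice, for f and for its composition
  with L, and reduces the comparison to derivatives of logarithms.\<close>

lemma pre_schwarzian_log_branch:
  fixes lh lg :: "complex \<Rightarrow> complex"
  defines "\<omega> \<equiv> \<lambda>w. deriv lg w / deriv lh w"
  assumes S: "open S" "z \<in> S" and lh: "log_branch S lh h" and lg: "log_branch S lg g"
    and nz: "deriv lh z \<noteq> 0"
  shows "pre_schwarzian h g z = deriv lh z + deriv (deriv lh) z / deriv lh z + \<omega> z * deriv lh z
           - deriv \<omega> z * cnj (\<omega> z) / (1 - complex_of_real ((cmod (\<omega> z))\<^sup>2))"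
proof -
  have hz: "h z \<noteq> 0"
    using log_branch_nonzero[OF lh] S by blast
  have hol: "lh holomorphic_on S"
    using lh by (simp add: log_branch_def)
  have "((\<lambda>w. exp (lh w)) has_field_derivative exp (lh z) * deriv lh z) (at z)"
    using hol S by (intro DERIV_fun_exp holomorphic_derivI)
  moreover have "(deriv lh has_field_derivative deriv (deriv lh) z) (at z)"
    using hol S by (intro holomorphic_derivI[of _ S] holomorphic_deriv)
  ultimately have "((\<lambda>w. exp (lh w) * deriv lh w) has_field_derivative
      exp (lh z) * (deriv lh z)\<^sup>2 + exp (lh z) * deriv (deriv lh) z) (at z)"
    using DERIV_mult by (fastforce simp: power2_eq_square algebra_simps)
  then have "(deriv h has_field_derivative
      exp (lh z) * (deriv lh z)\<^sup>2 + exp (lh z) * deriv (deriv lh) z) (at z)"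
    by (rule has_field_derivative_transform_within_open[OF _ S])
      (use lh S in \<open>auto simp: log_branch_def deriv_log_branch[OF S(1) lh]\<close>)
  then have h2: "deriv (deriv h) z = h z * ((deriv lh z)\<^sup>2 + deriv (deriv lh) z)"
    using lh S by (auto simp: log_branch_def distrib_left dest: DERIV_imp_deriv)
  have h1: "deriv h z = h z * deriv lh z"
    using deriv_log_branch[OF S(1) lh S(2)] .
  \<comment> \<open>The two functions are known to agree only on \<open>S\<close>; agreement near
    \<open>z\<close> is what makes their derivatives at \<open>z\<close> equal.\<close>
  have "eventually (\<lambda>w. dilatation h g w = \<omega> w) (nhds z)"
    using eventually_nhds_in_open[OF S]
    by eventually_elim (simp add: \<omega>_def dilatation_log_branch[OF S(1) lh lg])
  then have "deriv (dilatation h g) z = deriv \<omega> z" "dilatation h g z = \<omega> z"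
    by (auto intro: deriv_cong_ev dest: eventually_nhds_x_imp_x)
  moreover have "deriv (deriv h) z / deriv h z = deriv lh z + deriv (deriv lh) z / deriv lh z"
    using hz nz by (simp add: h1 h2 field_simps power2_eq_square)
  moreover have "deriv h z / h z = deriv lh z"
    using hz by (simp add: h1)
  ultimately show ?thesis
    by (simp add: pre_schwarzian_def)
qed

text \<open>Linear combinations of \<open>lh\<close> and \<open>lg\<close> are logarithms of the new
  factors, so the logarithmic formula for the pre-Schwarzian applies to the composition with no
  further handling of powers.\<close>

lemma log_branch_comp_H:
  assumes "log_branch S lh h" "log_branch S lg g"
  shows "log_branch S (\<lambda>z. a * lh z + cnj b * lg z) (comp_H a b lh lg)"
  using assms unfolding log_branch_def comp_H_def branch_power_def
  by (auto intro!: holomorphic_intros simp: exp_add)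

lemma log_branch_comp_G:
  assumes "log_branch S lh h" "log_branch S lg g"
  shows "log_branch S (\<lambda>z. b * lh z + cnj a * lg z) (comp_G a b lh lg)"
  using assms unfolding log_branch_def comp_G_def branch_power_def
  by (auto intro!: holomorphic_intros simp: exp_add)

text \<open>A zero would force |a| = |b| |w|, hence |a| at most |b|. This keeps the denominator of
  the Moebius map away from 0 on the unit disc.\<close>

lemma affine_nonzero:
  assumes "cmod b < cmod a" "cmod w < 1"
  shows "a + cnj b * w \<noteq> 0"
proof
  assume "a + cnj b * w = 0"
  then have "cmod a = cmod b * cmod w"
    by (metis add_eq_0_iff2 complex_mod_cnj norm_minus_cancel norm_mult)
  also have "\<dots> \<le> cmod b * 1"
    using assms by (intro mult_left_mono) auto
  finally show False
    using assms by simp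
qed

text \<open>The constant in the numerator is the determinant of the Moebius map, that is |a|^2 -
  |b|^2.\<close>

lemma deriv_Moebius_comp:
  assumes "w field_differentiable at z" "a + cnj b * w z \<noteq> 0"
  shows "deriv (\<lambda>z. (b + cnj a * w z) / (a + cnj b * w z)) z =
           deriv w z * (a * cnj a - b * cnj b) / (a + cnj b * w z)\<^sup>2"
proof (rule DERIV_imp_deriv)
  have "(w has_field_derivative deriv w z) (at z)"
    using assms(1) by (simp add: DERIV_deriv_iff_field_differentiable)
  then show "((\<lambda>z. (b + cnj a * w z) / (a + cnj b * w z)) has_field_derivative
      deriv w z * (a * cnj a - b * cnj b) / (a + cnj b * w z)\<^sup>2) (at z)"
    using assms(2)
    by (auto intro!: derivative_eq_intros simp: power2_eq_square algebra_simps)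
qed

text \<open>Here \<open>w'\<close> is a free parameter, later the derivative of the dilatation; the
  first summand is then the logarithmic derivative of \<open>N\<close>, and the second is the last
  term of the pre-Schwarzian for \<open>W\<close>.\<close>

lemma Moebius_dilatation_identity:
  fixes a b w w' :: complex
  assumes "cmod b < cmod a" "cmod w < 1"
  defines "N \<equiv> a + cnj b * w"
  defines "W \<equiv> (b + cnj a * w) / N"
  shows "cnj b * w' / N
           - w' * (a * cnj a - b * cnj b) / N\<^sup>2 * cnj W / (1 - complex_of_real ((cmod W)\<^sup>2))
         = - (w' * cnj w / (1 - complex_of_real ((cmod w)\<^sup>2)))"
proof -
  define D where "D = a * cnj a - b * cnj b"
  define r where "r = 1 - w * cnj w"
  have N: "N \<noteq> 0" "cnj N \<noteq> 0"
    using affine_nonzero[OF assms(1,2)] unfolding N_def complex_cnj_zero_iff by simp_all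
  \<comment> \<open>\<open>D\<close> and \<open>r\<close> are real and positive; only their being
    nonzero is kept, for the cancellations below.\<close>
  have "D = complex_of_real ((cmod a)\<^sup>2 - (cmod b)\<^sup>2)"
    unfolding D_def complex_norm_square of_real_diff ..
  moreover have "(cmod b)\<^sup>2 < (cmod a)\<^sup>2"
    using assms(1) by (simp add: power_strict_mono)
  ultimately have D: "D \<noteq> 0"
    by (simp only: of_real_eq_0_iff)
  have "r = complex_of_real (1 - (cmod w)\<^sup>2)"
    unfolding r_def of_real_diff complex_norm_square by simp
  moreover have "(cmod w)\<^sup>2 < 1"
    using assms(2) by (simp add: power_less_one_iff abs_square_less_1)
  ultimately have r: "r \<noteq> 0"
    by (simp only: of_real_eq_0_iff)
  have "1 - W * cnj W = (N * cnj N - (b + cnj a * w) * cnj (b + cnj a * w)) / (N * cnj N)"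
    using N by (simp add: W_def diff_divide_distrib)
  also have "N * cnj N - (b + cnj a * w) * cnj (b + cnj a * w) = D * r"
    by (simp add: N_def D_def r_def algebra_simps)
  finally have W: "1 - W * cnj W = D * r / (N * cnj N)" .
  \<comment> \<open>The determinant \<open>D\<close> from the derivative cancels against the one in
    1 - |W|^2, so the result involves only \<open>N\<close> and \<open>r\<close>.\<close>
  have "w' * D / N\<^sup>2 * cnj W / (1 - W * cnj W) = w' * cnj (b + cnj a * w) / (N * r)"
    unfolding W using N D r by (simp add: W_def power2_eq_square)
  moreover have "cnj b * r - cnj (b + cnj a * w) = - cnj w * N"
    by (simp add: N_def r_def algebra_simps)
  then have "cnj b * w' / N - w' * cnj (b + cnj a * w) / (N * r) = - (w' * cnj w / r)"
    using N r by (simp add: divide_simps) algebra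
  ultimately show ?thesis
    unfolding complex_norm_square D_def[symmetric] r_def[symmetric] by simp
qed

theorem proposition3:
  fixes \<Omega> :: "complex set" and f h g lh lg :: "complex \<Rightarrow> complex" and a b :: complex
  assumes "open \<Omega>" and "\<Omega> \<noteq> {}" and "simply_connected \<Omega>"
    and "sense_preserving_logharmonic \<Omega> f h g"
    and "log_branch \<Omega> lh h" and "log_branch \<Omega> lg g"
    and "a \<noteq> 0" and "cmod b < cmod a"
    and "a + b = 1"
  shows "\<forall>z\<in>\<Omega>. pre_schwarzian h g z = pre_schwarzian (comp_H a b lh lg) (comp_G a b lh lg) z"
proof
  fix z assume z: "z \<in> \<Omega>"
  note \<Omega> = assms(1) and lh = assms(5) and lg = assms(6)
  define u where "u = deriv lh"
  define \<omega> where "\<omega> = (\<lambda>w. deriv lg w / deriv lh w)"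
  define kh where "kh = (\<lambda>z. a * lh z + cnj b * lg z)"
  define kg where "kg = (\<lambda>z. b * lh z + cnj a * lg z)"
  have hol: "lh holomorphic_on \<Omega>" "lg holomorphic_on \<Omega>"
    using lh lg by (auto simp: log_branch_def)
  have u0: "u w \<noteq> 0" and \<omega>1: "cmod (\<omega> w) < 1" if "w \<in> \<Omega>" for w
    using assms(4) that deriv_log_branch[OF \<Omega> lh that] dilatation_log_branch[OF \<Omega> lh lg that]
    by (auto simp: sense_preserving_logharmonic_def u_def \<omega>_def)
  have N: "a + cnj b * \<omega> w \<noteq> 0" if "w \<in> \<Omega>" for w
    using affine_nonzero[OF assms(8) \<omega>1[OF that]] .
  have dl: "lh field_differentiable at w" "lg field_differentiable at w" if "w \<in> \<Omega>" for w
    using hol \<Omega> that holomorphic_on_imp_differentiable_at by blast+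
  \<comment> \<open>\<open>kh\<close> and \<open>kg\<close> are the logarithms of the new factors H
    and G; substituting \<open>deriv lg\<close> = \<omega> u pulls out the common factor
    \<open>u\<close>, which then cancels in the new dilatation.\<close>
  have kh': "deriv kh w = u w * (a + cnj b * \<omega> w)"
    and kg': "deriv kg w = u w * (b + cnj a * \<omega> w)" if "w \<in> \<Omega>" for w
  proof -
    have "deriv kh w = a * deriv lh w + cnj b * deriv lg w"
      "deriv kg w = b * deriv lh w + cnj a * deriv lg w"
      unfolding kh_def kg_def
      using dl[OF that]
      by (auto intro!: DERIV_imp_deriv derivative_eq_intros
          simp flip: DERIV_deriv_iff_field_differentiable)
    then show "deriv kh w = u w * (a + cnj b * \<omega> w)" "deriv kg w = u w * (b + cnj a * \<omega> w)"
      using u0[OF that] by (simp_all add: u_def \<omega>_def field_simps)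
  qed
  have "u holomorphic_on \<Omega>" "\<omega> holomorphic_on \<Omega>"
    using hol \<Omega> u0 unfolding u_def \<omega>_def by (auto intro!: holomorphic_intros)
  then have du: "(u has_field_derivative deriv u z) (at z)"
    and d\<omega>: "(\<omega> has_field_derivative deriv \<omega> z) (at z)"
    using \<Omega> z holomorphic_derivI by blast+
  have "((\<lambda>w. u w * (a + cnj b * \<omega> w)) has_field_derivative
      deriv u z * (a + cnj b * \<omega> z) + u z * (cnj b * deriv \<omega> z)) (at z)"
    by (auto intro!: derivative_eq_intros du d\<omega>)
  then have "(deriv kh has_field_derivative
      deriv u z * (a + cnj b * \<omega> z) + u z * (cnj b * deriv \<omega> z)) (at z)"
    by (rule has_field_derivative_transform_within_open[OF _ \<Omega> z]) (simp add: kh')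
  \<comment> \<open>The logarithmic derivative of a product splits into a sum: one part from
    \<open>u\<close>, one from the affine factor.\<close>
  then have kh'': "deriv (deriv kh) z / deriv kh z
      = deriv u z / u z + cnj b * deriv \<omega> z / (a + cnj b * \<omega> z)"
    using N[OF z] u0[OF z] by (simp add: DERIV_imp_deriv kh' z add_divide_distrib)
  define W where "W = (\<lambda>w. (b + cnj a * \<omega> w) / (a + cnj b * \<omega> w))"
  have "eventually (\<lambda>w. deriv kg w / deriv kh w = W w) (nhds z)"
    using eventually_nhds_in_open[OF \<Omega> z]
    by eventually_elim (simp add: kh' kg' u0 W_def)
  then have W: "deriv (\<lambda>w. deriv kg w / deriv kh w) z = deriv W z"
    "deriv kg z / deriv kh z = W z"
    by (auto intro: deriv_cong_ev dest: eventually_nhds_x_imp_x)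
  have W': "deriv W z = deriv \<omega> z * (a * cnj a - b * cnj b) / (a + cnj b * \<omega> z)\<^sup>2"
    unfolding W_def using d\<omega> N[OF z]
    by (intro deriv_Moebius_comp) (auto simp: field_differentiable_def)
  \<comment> \<open>The hypothesis \<open>a + b = 1\<close> enters through the first-order terms
    alone: directly as the coefficient of \<open>u\<close>, conjugated as that of \<omega>
    u.\<close>
  have "cnj a + cnj b = 1"
    using assms(9) by (metis complex_cnj_add complex_cnj_one)
  moreover have "u z * (a + cnj b * \<omega> z) + u z * (b + cnj a * \<omega> z)
      = u z * (a + b) + \<omega> z * u z * (cnj a + cnj b)"
    by (simp add: algebra_simps)
  moreover have "W z * deriv kh z = u z * (b + cnj a * \<omega> z)"
    using N[OF z] by (simp add: W_def kh' z)
  ultimately have first_order: "deriv kh z + W z * deriv kh z = u z + \<omega> z * u z"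
    using assms(9) by (simp only: kh'[OF z] mult_1_right)
  have "deriv kh z \<noteq> 0"
    using u0[OF z] N[OF z] by (simp add: kh' z)
  then have "pre_schwarzian (comp_H a b lh lg) (comp_G a b lh lg) z
      = deriv kh z + deriv (deriv kh) z / deriv kh z + W z * deriv kh z
        - deriv W z * cnj (W z) / (1 - complex_of_real ((cmod (W z))\<^sup>2))"
    using pre_schwarzian_log_branch[OF \<Omega> z log_branch_comp_H[OF lh lg] log_branch_comp_G[OF lh lg],
        of a b a b, folded kh_def kg_def]
    by (simp only: W not_False_eq_True simp_thms)
  \<comment> \<open>Grouped so that the first bracket is invariant by \<open>first_order\<close> and
    the last one by the Moebius identity, while u'/u is common to both sides.\<close>
  also have "\<dots> = (deriv kh z + W z * deriv kh z) + deriv u z / u z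
      + (cnj b * deriv \<omega> z / (a + cnj b * \<omega> z)
        - deriv W z * cnj (W z) / (1 - complex_of_real ((cmod (W z))\<^sup>2)))"
    unfolding kh'' by (simp add: algebra_simps)
  also have "\<dots> = u z + deriv u z / u z + \<omega> z * u z
      - deriv \<omega> z * cnj (\<omega> z) / (1 - complex_of_real ((cmod (\<omega> z))\<^sup>2))"
    unfolding first_order W'
    using Moebius_dilatation_identity[OF assms(8) \<omega>1[OF z], of "deriv \<omega> z"]
    by (simp add: W_def)
  also have "\<dots> = pre_schwarzian h g z"
    using pre_schwarzian_log_branch[OF \<Omega> z lh lg] u0[OF z] by (simp add: u_def \<omega>_def)
  finally show "pre_schwarzian h g z = pre_schwarzian (comp_H a b lh lg) (comp_G a b lh lg) z" ..
qed

end
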